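(* Let $(S,* )$ be an adequate partial semigroup, let $n\in\mathbb{N}$, and let $f(1),\dots,f(n)$ be elements of $S$ such that for every nonempty $H\subseteq\{1,\dots,n\}$, $\prod_{t\in H}f(t)$ is defined. If $\mathcal{T}\neq\emptyset$, then $f$ can be extended to an adequate sequence $\langle f(t)\rangle_{t=1}^\infty$.
   Context: A partial semigroup is a pair $(S,* )$ where $S$ is a nonempty set and $*$ is an operation defined on a nonempty subset of $S\times S$ such that for all $x,y,z\in S$, $(x*y)*z=x*(y*z)$ in the sense that if either side is defined then so is the other and they are equal. For $a\in S$, $\varphi(a)=\{b\in S: a*b \text{ is defined}\}$; for finite nonempty $F\subseteq S$, $\sigma(F)=\bigcap_{a\in F}\varphi(a)$. $(S,* )$ is adequate if $\sigma(F)\neq\emptyset$ for all finite nonempty $F$. $\mathcal{P}_f(X)$ denotes the set of finite nonempty subsets of $X$. Products $\prod_{t\in H}f(t)$ are computed in increasing order of indices. A sequence $f:\mathbb{N}\to S$ is adequate if (i) for each $H\in\mathcal{P}_f(\mathbb{N})$, $\prod_{t\in H}f(t)$ is defined, and (ii) for each $F\in\mathcal{P}_f(S)$ there is $m\in\mathbb{N}$ such that $\prod_{t\in H}f(t)\in\sigma(F)$ for all $H\in\mathcal{P}_f(\mathbb{N})$ with $\min H\geq m$. $\mathcal{T}$ denotes the set of adequate sequences in $S$. *)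

theory Defs
  imports Main "HOL-Library.FuncSet"
begin

text \<open>
  A partial operation is a function into the option type; the value \<open>None\<close> means that the product is
  undefined. In \<open>assoc\<close>, each side is defined iff both products occurring in it are defined.
\<close>

locale partial_semigroup =
  fixes S :: "'a set" and mult :: "'a \<Rightarrow> 'a \<Rightarrow> 'a option"
  assumes carrier_nonempty: "S \<noteq> {}"
    and mult_dom: "mult x y \<noteq> None \<Longrightarrow> x \<in> S \<and> y \<in> S"
    and mult_closed: "mult x y = Some z \<Longrightarrow> z \<in> S"
    and dom_nonempty: "\<exists>x y. mult x y \<noteq> None"
    and assoc: "\<lbrakk>x \<in> S; y \<in> S; z \<in> S\<rbrakk> \<Longrightarrow>
      Option.bind (mult x y) (\<lambda>u. mult u z) = Option.bind (mult y z) (\<lambda>v. mult x v)"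

definition Pf :: "'b set \<Rightarrow> 'b set set" where
  "Pf X = {F. F \<subseteq> X \<and> finite F \<and> F \<noteq> {}}"

definition phi :: "'a set \<Rightarrow> ('a \<Rightarrow> 'a \<Rightarrow> 'a option) \<Rightarrow> 'a \<Rightarrow> 'a set" where
  "phi S mult a = {b \<in> S. mult a b \<noteq> None}"

definition sigma :: "'a set \<Rightarrow> ('a \<Rightarrow> 'a \<Rightarrow> 'a option) \<Rightarrow> 'a set \<Rightarrow> 'a set" where
  "sigma S mult F = (\<Inter>a\<in>F. phi S mult a)"

locale adequate_partial_semigroup = partial_semigroup +
  assumes adequate: "F \<in> Pf S \<Longrightarrow> sigma S mult F \<noteq> {}"

text \<open>
  For \<open>t1 < ... < tk\<close> the elements of \<open>H\<close>, this is \<open>((f t1 * f t2) * ...) * f tk\<close>, which is undefined as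
  soon as one of the partial products is. It is only meant for finite nonempty \<open>H\<close>.
\<close>

definition pprod :: "('a \<Rightarrow> 'a \<Rightarrow> 'a option) \<Rightarrow> (nat \<Rightarrow> 'a) \<Rightarrow> nat set \<Rightarrow> 'a option" where
  "pprod mult f H =
    (case sorted_list_of_set H of
       [] \<Rightarrow> None
     | t # ts \<Rightarrow> foldl (\<lambda>p s. Option.bind p (\<lambda>x. mult x (f s))) (Some (f t)) ts)"

text \<open>
  Sequences are indexed by the positive integers, so the value at \<open>0\<close> is irrelevant; it is fixed to
  \<open>undefined\<close> by the extensional function space.
\<close>

definition adequate_seqs :: "'a set \<Rightarrow> ('a \<Rightarrow> 'a \<Rightarrow> 'a option) \<Rightarrow> (nat \<Rightarrow> 'a) set" where
  "adequate_seqs S mult =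
    {f \<in> {1..} \<rightarrow>\<^sub>E S.
      (\<forall>H \<in> Pf {1..}. pprod mult f H \<noteq> None) \<and>
      (\<forall>F \<in> Pf S. \<exists>m\<ge>1. \<forall>H \<in> Pf {1..}. Min H \<ge> m \<longrightarrow>
        (\<exists>p \<in> sigma S mult F. pprod mult f H = Some p))}"

end

(* If h is an adequate sequence, some tail of h has all its products in sigma F, where F is the finite
   set of products of f over nonempty subsets of {1..n}. Prepending f(1), ..., f(n) to that tail
   keeps all products defined, and (ii) is a statement about tails only. *)

theory Submission
  imports Defs
begin

text \<open>Separating products from index sets makes list append and induction from the right end
  available. The empty product counts as undefined, not as a unit, which is why later lemmas ask for
  nonempty lists.\<close>

definition list_mult :: "('a \<Rightarrow> 'a \<Rightarrow> 'a option) \<Rightarrow> 'a list \<Rightarrow> 'a option" where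
  "list_mult mult xs = (case xs of [] \<Rightarrow> None
     | x # ys \<Rightarrow> foldl (\<lambda>p y. Option.bind p (\<lambda>x. mult x y)) (Some x) ys)"

lemma pprod_eq_list_mult: "pprod mult f H = list_mult mult (map f (sorted_list_of_set H))"
  by (simp add: pprod_def list_mult_def foldl_map split: list.split)

lemma list_mult_singleton [simp]: "list_mult mult [x] = Some x"
  by (simp add: list_mult_def)

lemma list_mult_snoc:
  "xs \<noteq> [] \<Longrightarrow> list_mult mult (xs @ [y]) = Option.bind (list_mult mult xs) (\<lambda>x. mult x y)"
  by (cases xs) (simp_all add: list_mult_def)

lemma pprod_cong: "(\<And>t. t \<in> H \<Longrightarrow> f t = g t) \<Longrightarrow> finite H \<Longrightarrow> pprod mult f H = pprod mult g H"
  unfolding pprod_eq_list_mult by (rule arg_cong[of _ _ "list_mult mult"]) simp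

text \<open>A strictly increasing \<open>r\<close> keeps the factors in order: mapping it over the
  sorted list of \<open>H\<close> gives a strictly sorted list, and such a list is determined by its
  set.\<close>

lemma pprod_reindex:
  assumes "strict_mono r"
  shows "pprod mult (f \<circ> r) H = pprod mult f (r ` H)"
proof (cases "finite H")
  case True
  have "sorted_wrt (<) (map r (sorted_list_of_set H))"
    using assms by (auto simp: sorted_wrt_map strict_mono_less)
  then have "map r (sorted_list_of_set H) = sorted_list_of_set (r ` H)"
    using True sorted_list_of_set.idem_if_sorted_distinct[of "map r (sorted_list_of_set H)"]
    by (simp add: strict_sorted_iff)
  then show ?thesis
    by (simp add: pprod_eq_list_mult flip: map_map)
next
  \<comment> \<open>\<open>sorted_list_of_set\<close> is \<open>[]\<close> on infinite sets, so both
    products are \<open>None\<close>; injectivity of \<open>r\<close> keeps the image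
    infinite.\<close>
  case False
  moreover have "infinite (r ` H)"
    using False assms by (metis finite_imageD inj_on_subset strict_mono_imp_inj_on subset_UNIV)
  ultimately show ?thesis
    by (simp add: pprod_eq_list_mult)
qed

lemma adequate_seqs_tail:
  assumes "f \<in> adequate_seqs S mult" "F \<in> Pf S"
  shows "\<exists>m. \<forall>H \<in> Pf {1..}. Min H \<ge> m \<longrightarrow> (\<exists>p \<in> sigma S mult F. pprod mult f H = Some p)"
proof -
  have "\<forall>F \<in> Pf S. \<exists>m\<ge>1. \<forall>H \<in> Pf {1..}. Min H \<ge> m \<longrightarrow>
      (\<exists>p \<in> sigma S mult F. pprod mult f H = Some p)"
    using assms(1) by (simp add: adequate_seqs_def)
  then show ?thesis
    using assms(2) by blast
qed

lemma sorted_list_of_set_Un: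
  fixes A B :: "'b::linorder set"
  assumes "finite A" "finite B" and "\<And>a b. a \<in> A \<Longrightarrow> b \<in> B \<Longrightarrow> a < b"
  shows "sorted_list_of_set (A \<union> B) = sorted_list_of_set A @ sorted_list_of_set B"
proof -
  have "sorted_wrt (<) (sorted_list_of_set A @ sorted_list_of_set B)"
    using assms by (auto simp: sorted_wrt_append)
  moreover have "set (sorted_list_of_set A @ sorted_list_of_set B) = A \<union> B"
    using assms by simp
  ultimately show ?thesis
    using sorted_list_of_set.idem_if_sorted_distinct strict_sorted_iff by metis
qed

context partial_semigroup
begin

lemma list_mult_in_carrier:
  assumes "list_mult mult xs = Some p" "set xs \<subseteq> S"
  shows "p \<in> S"
proof (cases xs rule: rev_cases)
  case Nil
  then show ?thesis using assms by (simp add: list_mult_def)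
next
  case (snoc ys y)
  then show ?thesis
    using assms by (cases "ys = []") (auto simp: list_mult_snoc bind_eq_Some_conv dest: mult_closed)
qed

text \<open>General associativity for a partial operation. Being an equation of options, it also
  says that the two sides are defined together. The induction peels off the last factor of
  \<open>ys\<close>.\<close>

lemma list_mult_append:
  assumes "xs \<noteq> []" "ys \<noteq> []" "set xs \<subseteq> S" "set ys \<subseteq> S"
  shows "list_mult mult (xs @ ys) =
    Option.bind (list_mult mult xs) (\<lambda>x. Option.bind (list_mult mult ys) (mult x))"
  using assms(2,4)
proof (induction ys rule: rev_induct)
  case Nil
  then show ?case by simp
next
  case (snoc y ys)
  show ?case
  proof (cases "ys = []")
    case True
    then show ?thesis using assms by (simp add: list_mult_snoc)
  next
    case False
    have IH: "list_mult mult (xs @ ys) =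
        Option.bind (list_mult mult xs) (\<lambda>x. Option.bind (list_mult mult ys) (mult x))"
      using snoc False by simp
    have step: "list_mult mult (xs @ ys @ [y]) = Option.bind (list_mult mult (xs @ ys)) (\<lambda>x. mult x y)"
      using list_mult_snoc[of "xs @ ys" mult y] False by simp
    show ?thesis
    proof (cases "list_mult mult xs")
      case None
      then show ?thesis
        by (simp add: step IH)
    next
      case x: (Some x)
      show ?thesis
      proof (cases "list_mult mult ys")
        case None
        then show ?thesis
          using False x by (simp add: step IH list_mult_snoc)
      next
        case z: (Some z)
        have "x \<in> S" "z \<in> S" "y \<in> S"
          using x z snoc.prems assms by (auto intro: list_mult_in_carrier)
        \<comment> \<open>The last factor \<open>y\<close> is moved from \<open>(x * z) * y\<close>
          to \<open>x * (z * y)\<close>; \<open>assoc\<close> is available only inside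
          \<open>S\<close>, hence the three memberships.\<close>
        then have "Option.bind (mult x z) (\<lambda>u. mult u y) = Option.bind (mult z y) (mult x)"
          by (rule assoc)
        then show ?thesis
          using False x z by (simp add: step IH list_mult_snoc)
      qed
    qed
  qed
qed

lemma pprod_in_carrier:
  "pprod mult f H = Some p \<Longrightarrow> finite H \<Longrightarrow> f ` H \<subseteq> S \<Longrightarrow> p \<in> S"
  using list_mult_in_carrier by (simp add: pprod_eq_list_mult)

text \<open>Used to cut a product at index \<open>n\<close>: whether the whole is defined then
  depends on the two halves and one multiplication.\<close>

lemma pprod_Un:
  assumes "A \<in> Pf UNIV" "B \<in> Pf UNIV" "f ` A \<subseteq> S" "f ` B \<subseteq> S"
    and "\<And>a b. a \<in> A \<Longrightarrow> b \<in> B \<Longrightarrow> a < b"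
  shows "pprod mult f (A \<union> B) =
    Option.bind (pprod mult f A) (\<lambda>x. Option.bind (pprod mult f B) (mult x))"
proof -
  have "sorted_list_of_set (A \<union> B) = sorted_list_of_set A @ sorted_list_of_set B"
    using assms by (intro sorted_list_of_set_Un) (auto simp: Pf_def)
  then show ?thesis
    using assms by (simp add: pprod_eq_list_mult list_mult_append Pf_def)
qed

end

theorem theorem5p2:
  fixes S :: "'a set" and mult :: "'a \<Rightarrow> 'a \<Rightarrow> 'a option"
    and n :: nat and f :: "nat \<Rightarrow> 'a"
  assumes "adequate_partial_semigroup S mult"
    and "n \<ge> 1"
    and "\<forall>t \<in> {1..n}. f t \<in> S"
    and "\<forall>H. H \<subseteq> {1..n} \<and> H \<noteq> {} \<longrightarrow> pprod mult f H \<noteq> None"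
    and "adequate_seqs S mult \<noteq> {}"
  shows "\<exists>g \<in> adequate_seqs S mult. \<forall>t \<in> {1..n}. g t = f t"
proof -
  interpret adequate_partial_semigroup S mult by fact
  obtain h where h: "h \<in> adequate_seqs S mult"
    using assms(5) by blast
  \<comment> \<open>By the hypothesis on \<open>f\<close>, \<open>the\<close> is applied only to
    defined products here.\<close>
  define F where "F = (\<lambda>H. the (pprod mult f H)) ` (Pow {1..n} - {{}})"
  have "F \<in> Pf S"
  proof -
    have "the (pprod mult f H) \<in> S" if H: "H \<subseteq> {1..n}" "H \<noteq> {}" for H
    proof -
      obtain p where "pprod mult f H = Some p"
        using assms(4) H by blast
      moreover have "f ` H \<subseteq> S"
        using H(1) assms(3) by blast
      ultimately show ?thesis
        using pprod_in_carrier finite_subset[OF H(1)] by simp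
    qed
    \<comment> \<open>\<open>F\<close> must be nonempty to lie in \<open>Pf S\<close>; this is where
      \<open>n \<ge> 1\<close> enters.\<close>
    moreover have "{1} \<in> Pow {1..n} - {{}}"
      using assms(2) by auto
    ultimately show ?thesis
      by (auto simp: F_def Pf_def)
  qed
  then obtain m where m: "\<And>H. H \<in> Pf {1..} \<Longrightarrow> Min H \<ge> m \<Longrightarrow>
      \<exists>p \<in> sigma S mult F. pprod mult h H = Some p"
    using adequate_seqs_tail[OF h] by metis
  \<comment> \<open>The value at \<open>0\<close> is forced by extensionality. Beyond
    \<open>n\<close>, shifting by \<open>m\<close> sends every index past \<open>m\<close>, into the
    good tail of \<open>h\<close>.\<close>
  define g where "g t = (if t = 0 then undefined else if t \<le> n then f t else h (t + m))" for t
  have gS: "g \<in> {1..} \<rightarrow>\<^sub>E S"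
    using h assms(3) by (auto simp: g_def adequate_seqs_def PiE_def Pi_def extensional_def)
  have low: "pprod mult g H = pprod mult f H" if "H \<subseteq> {1..n}" for H
    using that finite_subset[OF that] by (intro pprod_cong) (auto simp: g_def)
  have high: "pprod mult g H = pprod mult h ((\<lambda>t. t + m) ` H)" if "H \<subseteq> {n<..}" "finite H" for H
  proof -
    have "pprod mult g H = pprod mult (h \<circ> (\<lambda>t. t + m)) H"
      using that by (intro pprod_cong) (auto simp: g_def)
    then show ?thesis
      by (simp add: pprod_reindex strict_mono_def)
  qed
  have shift: "(\<lambda>t. t + m) ` H \<in> Pf {1..} \<and> Min ((\<lambda>t. t + m) ` H) = Min H + m"
    if "H \<in> Pf {n<..}" for H
    using that Min_add_commute[of H "\<lambda>t. t" m] by (auto simp: Pf_def)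
  \<comment> \<open>The shifted set has minimum \<open>Min H + m\<close>, so the choice of
    \<open>m\<close> applies to it automatically.\<close>
  have tail: "\<exists>p \<in> sigma S mult F. pprod mult g H = Some p" if "H \<in> Pf {n<..}" for H
    using m[of "(\<lambda>t. t + m) ` H"] shift[OF that] high[of H] that by (simp add: Pf_def)
  have "pprod mult g H \<noteq> None" if H: "H \<in> Pf {1..}" for H
  proof -
    \<comment> \<open>Cut \<open>H\<close> at \<open>n\<close>: a product over the lower part alone
      is defined by hypothesis, one over the upper part alone by \<open>tail\<close>; only a mixed
      product needs the choice of \<open>F\<close>.\<close>
    have "H = H \<inter> {1..n} \<union> H \<inter> {n<..}"
      using H by (force simp: Pf_def)
    then obtain A B where HAB: "H = A \<union> B" and A: "A \<subseteq> {1..n}" and B: "B \<subseteq> {n<..}"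
      by blast
    have fin: "finite A" "finite B"
      using H unfolding HAB by (simp_all add: Pf_def)
    consider "B = {}" | "A = {}" | "A \<noteq> {}" "B \<noteq> {}" by blast
    then show ?thesis
    proof cases
      case 1
      then show ?thesis
        using H HAB A low assms(4) by (simp add: Pf_def)
    next
      case 2
      then have "H \<in> Pf {n<..}"
        using H HAB B by (simp add: Pf_def)
      then show ?thesis using tail by fastforce
    next
      case 3
      have B': "B \<in> Pf {n<..}"
        using 3 fin B by (simp add: Pf_def)
      obtain a where a: "pprod mult f A = Some a"
        using assms(4) A 3 by blast
      then have "a \<in> F"
        using A 3 unfolding F_def by (intro rev_image_eqI[of A]) simp_all
      obtain p where p: "p \<in> sigma S mult F" "pprod mult g B = Some p"
        using tail[OF B'] by blast
      then have "mult a p \<noteq> None"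
        using \<open>a \<in> F\<close> by (auto simp: sigma_def phi_def)
      moreover have "g ` A \<subseteq> S" "g ` B \<subseteq> S"
        using gS H unfolding HAB by (auto simp: Pf_def)
      \<comment> \<open>The product collapses to \<open>mult a p\<close>, which is defined because
        \<open>p\<close> lies in \<open>sigma S mult F\<close> and \<open>a\<close> in
        \<open>F\<close>.\<close>
      then have "pprod mult g H =
          Option.bind (pprod mult g A) (\<lambda>x. Option.bind (pprod mult g B) (mult x))"
        unfolding HAB using 3 fin A B by (intro pprod_Un) (auto simp: Pf_def dest!: subsetD)
      ultimately show ?thesis
        using low[OF A] a p by simp
    qed
  qed
  moreover have "\<exists>k\<ge>1. \<forall>H \<in> Pf {1..}. Min H \<ge> k \<longrightarrow>
      (\<exists>p \<in> sigma S mult E. pprod mult g H = Some p)" if E: "E \<in> Pf S" for E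
  proof -
    obtain k where k: "\<And>H. H \<in> Pf {1..} \<Longrightarrow> Min H \<ge> k \<Longrightarrow>
        \<exists>p \<in> sigma S mult E. pprod mult h H = Some p"
      using adequate_seqs_tail[OF h E] by metis
    \<comment> \<open>The bound \<open>Suc n\<close> puts \<open>H\<close> above \<open>n\<close>,
      where products of \<open>g\<close> are shifted products of \<open>h\<close>; the bound
      \<open>k\<close> survives because the shift only raises minima.\<close>
    have "\<exists>p \<in> sigma S mult E. pprod mult g H = Some p"
      if H: "H \<in> Pf {1..}" "Min H \<ge> max k (Suc n)" for H
    proof -
      have H': "H \<in> Pf {n<..}"
        using H by (auto simp: Pf_def)
      have "Min ((\<lambda>t. t + m) ` H) \<ge> k"
        using shift[OF H'] H(2) by linarith
      then show ?thesis
        using k[of "(\<lambda>t. t + m) ` H"] shift[OF H'] high[of H] H' by (simp add: Pf_def)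
    qed
    moreover have "max k (Suc n) \<ge> 1"
      by simp
    ultimately show ?thesis
      by blast
  qed
  ultimately have "g \<in> adequate_seqs S mult"
    using gS unfolding adequate_seqs_def by blast
  moreover have "\<forall>t \<in> {1..n}. g t = f t"
    by (simp add: g_def)
  ultimately show ?thesis by blast
qed

end
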